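(* Let $q(x)=Mx+b$ with $\|M\|\le1$. Let $x_0,x_1\in\mathbb{R}^n$ be initial guesses whose residuals satisfy $\|r_1\|\le\|r_0\|$, and let $(x_k)_{k\ge0}$ be generated from the general initial guess $\{x_0,x_1\}$ by the AA(1) iteration $$x_{k+1}=q(x_k)+\beta_k\big(q(x_k)-q(x_{k-1})\big),\qquad k=1,2,\ldots.$$ Then the AA(1) coefficients satisfy $$\beta_k>-1,\qquad k=1,2,\ldots.$$
   Context: Setting: $M\in\mathbb{R}^{n\times n}$, $b\in\mathbb{R}^n$, $A=I-M$ is nonsingular and $M\neq 0$. $\|\cdot\|$ is the vector 2-norm and the induced matrix norm. The residuals are $r_k=x_k-q(x_k)=Ax_k-b$. The AA(1) coefficients are $\beta_k=\dfrac{-r_k^T(r_k-r_{k-1})}{\|r_k-r_{k-1}\|^2}$ if $r_k\ne r_{k-1}$, and $\beta_k=0$ if $r_k=r_{k-1}$. Here $x_1$ is arbitrary (not necessarily $q(x_0)$) subject to the stated condition. *)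

theory Defs
  imports "HOL-Analysis.Analysis"
begin

definition affine_map :: "real^'n^'n \<Rightarrow> real^'n \<Rightarrow> real^'n \<Rightarrow> real^'n" where
  "affine_map M b x = M *v x + b"

definition residual :: "('a::real_inner \<Rightarrow> 'a) \<Rightarrow> 'a \<Rightarrow> 'a" where
  "residual q x = x - q x"

definition aa1_coeff :: "('a::real_inner \<Rightarrow> 'a) \<Rightarrow> (nat \<Rightarrow> 'a) \<Rightarrow> nat \<Rightarrow> real" where
  "aa1_coeff q x k =
     (let r = residual q (x k); r' = residual q (x (k - 1)) in
      if r = r' then 0 else - (r \<bullet> (r - r')) / (norm (r - r'))\<^sup>2)"

text \<open>The initial guesses \<^term>\<open>x 0\<close> and \<^term>\<open>x (1::nat)\<close> are left unconstrained
  (the general initial guess); \<^term>\<open>aa1_coeff q x k\<close> is only meaningful for \<open>k \<ge> 1\<close>.\<close>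

definition aa1_iteration :: "('a::real_inner \<Rightarrow> 'a) \<Rightarrow> (nat \<Rightarrow> 'a) \<Rightarrow> bool" where
  "aa1_iteration q x \<longleftrightarrow>
     (\<forall>k\<ge>1. x (k + 1) = q (x k) + aa1_coeff q x k *\<^sub>R (q (x k) - q (x (k - 1))))"

end

theory Submission
  imports Defs
begin

text \<open>
  The coefficient \<^term>\<open>aa1_coeff q x k\<close> is chosen by least squares: it minimizes the norm of
  \<open>r\<^sub>k + \<beta> (r\<^sub>k - r\<^sub>k\<^sub>-\<^sub>1)\<close> over all real \<open>\<beta>\<close>. Comparing the minimizer with \<open>\<beta> = 0\<close> gives
  \<open>\<parallel>r\<^sub>k + \<beta>\<^sub>k (r\<^sub>k - r\<^sub>k\<^sub>-\<^sub>1)\<parallel> \<le> \<parallel>r\<^sub>k\<parallel>\<close> (lemma \<open>norm_mixed_residual_le\<close>). For the affine map \<open>q\<close>, the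
  vector on the left is the residual of the mixed point \<open>y = x\<^sub>k + \<beta>\<^sub>k (x\<^sub>k - x\<^sub>k\<^sub>-\<^sub>1)\<close>, and
  \<open>x\<^sub>k\<^sub>+\<^sub>1 = q y\<close>, so that \<open>r\<^sub>k\<^sub>+\<^sub>1\<close> is \<open>M\<close> applied to it (lemma \<open>residual_affine_step\<close>). As \<open>M\<close> does not
  expand norms, the residual norms decrease weakly, starting with the hypothesis on \<open>r\<^sub>0\<close> and
  \<open>r\<^sub>1\<close>.

  It remains to see that \<open>\<parallel>r\<^sub>k\<parallel> \<le> \<parallel>r\<^sub>k\<^sub>-\<^sub>1\<parallel>\<close> forces \<open>\<beta>\<^sub>k > -1\<close> (lemma
  \<open>aa1_coeff_greater_minus_one\<close>). Here \<open>\<beta> = -1\<close> is the value at which the mixed residual is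
  \<open>r\<^sub>k\<^sub>-\<^sub>1\<close>; the squared norm of the mixed residual is a quadratic in \<open>\<beta>\<close> which is at \<open>\<beta> = 0\<close> no
  larger than at \<open>\<beta> = -1\<close>, so its minimizer lies to the right of the midpoint \<open>-1/2\<close> or on it.
  The bound \<open>-1\<close> is therefore strict. If the two residuals agree, the quadratic is constant and the
  convention \<open>\<beta>\<^sub>k = 0\<close> applies.
\<close>

lemma norm_mixed_residual_le:
  fixes q :: "'a::real_inner \<Rightarrow> 'a" and x :: "nat \<Rightarrow> 'a"
  defines "r \<equiv> \<lambda>k. residual q (x k)"
  shows "norm (r k + aa1_coeff q x k *\<^sub>R (r k - r (k - 1))) \<le> norm (r k)"
proof (cases "r k = r (k - 1)")
  case False
  define d where "d = r k - r (k - 1)"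
  define \<beta> where "\<beta> = aa1_coeff q x k"
  have "d \<bullet> d \<noteq> 0"
    using False by (simp add: d_def)
  moreover have "\<beta> = - (r k \<bullet> d) / (d \<bullet> d)"
    using False by (simp add: \<beta>_def aa1_coeff_def Let_def d_def r_def dot_square_norm)
  ultimately have normal_equation: "r k \<bullet> d = - \<beta> * (d \<bullet> d)"
    by simp
  have "(norm (r k + \<beta> *\<^sub>R d))\<^sup>2 = r k \<bullet> r k + 2 * \<beta> * (r k \<bullet> d) + \<beta>\<^sup>2 * (d \<bullet> d)"
    unfolding power2_norm_eq_inner
    by (simp add: inner_simps inner_commute power2_eq_square algebra_simps)
  also have "\<dots> = (norm (r k))\<^sup>2 - \<beta>\<^sup>2 * (d \<bullet> d)"
    unfolding power2_norm_eq_inner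
    by (simp add: normal_equation power2_eq_square)
  also have "\<dots> \<le> (norm (r k))\<^sup>2"
    by simp
  finally show ?thesis
    by (simp add: power2_le_iff_abs_le \<beta>_def d_def)
qed simp

lemma aa1_coeff_greater_minus_one:
  fixes q :: "'a::real_inner \<Rightarrow> 'a"
  assumes "norm (residual q (x k)) \<le> norm (residual q (x (k - 1)))"
  shows "aa1_coeff q x k > -1"
proof (cases "residual q (x k) = residual q (x (k - 1))")
  case True
  then show ?thesis
    by (simp add: aa1_coeff_def)
next
  case False
  define r r' where "r = residual q (x k)" and "r' = residual q (x (k - 1))"
  have pos: "(r - r') \<bullet> (r - r') > 0"
    using False by (simp add: r_def r'_def)
  have "r \<bullet> r \<le> r' \<bullet> r'"
    using assms by (simp add: r_def r'_def norm_le)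
  \<comment> \<open>The identity \<open>2 r \<bullet> (r - r') = \<parallel>r - r'\<parallel>\<^sup>2 + \<parallel>r\<parallel>\<^sup>2 - \<parallel>r'\<parallel>\<^sup>2\<close> expresses the midpoint bound.\<close>
  then have "2 * (r \<bullet> (r - r')) \<le> (r - r') \<bullet> (r - r')"
    by (simp add: inner_simps inner_commute)
  then have "r \<bullet> (r - r') < (r - r') \<bullet> (r - r')"
    using pos by linarith
  then have "r \<bullet> (r - r') / ((r - r') \<bullet> (r - r')) < 1"
    using pos by simp
  then show ?thesis
    using False by (simp add: aa1_coeff_def Let_def r_def r'_def dot_square_norm)
qed

text \<open>
  An affine map commutes with affine combinations, so one step of the iteration with any mixing
  parameter \<open>c\<close> is \<open>q\<close> evaluated at a mixed point \<open>y\<close>; and the residual of \<open>q y\<close> is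
  \<open>q y - q (q y) = M (y - q y)\<close>.
\<close>

lemma residual_affine_step:
  fixes M :: "real^'n^'n" and b :: "real^'n"
  defines "q \<equiv> affine_map M b"
  shows "residual q (q u + c *\<^sub>R (q u - q v))
    = M *v (residual q u + c *\<^sub>R (residual q u - residual q v))"
  by (simp add: q_def residual_def affine_map_def matrix_vector_right_distrib
      matrix_vector_mult_diff_distrib matrix_vector_mult_scaleR algebra_simps)

lemma norm_residual_decreasing:
  fixes M :: "real^'n^'n" and b :: "real^'n" and x :: "nat \<Rightarrow> real^'n"
  defines "r \<equiv> \<lambda>k. residual (affine_map M b) (x k)"
  assumes "onorm ((*v) M) \<le> 1" and "aa1_iteration (affine_map M b) x" and "k \<ge> 1"
  shows "norm (r (k + 1)) \<le> norm (r k)"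
proof -
  define z where "z = r k + aa1_coeff (affine_map M b) x k *\<^sub>R (r k - r (k - 1))"
  have "x (k + 1) = affine_map M b (x k) + aa1_coeff (affine_map M b) x k *\<^sub>R
      (affine_map M b (x k) - affine_map M b (x (k - 1)))"
    using assms(3,4) unfolding aa1_iteration_def by blast
  then have "r (k + 1) = M *v z"
    unfolding r_def z_def by (simp only: residual_affine_step)
  also have "norm (M *v z) \<le> onorm ((*v) M) * norm z"
    by (rule onorm[OF matrix_vector_mul_bounded_linear])
  also have "\<dots> \<le> norm z"
    using assms(2) by (simp add: mult_left_le_one_le onorm_pos_le)
  also have "\<dots> \<le> norm (r k)"
    unfolding z_def r_def by (rule norm_mixed_residual_le)
  finally show ?thesis .
qed

theorem proposition3p5:
  fixes M :: "real^'n^'n" and b :: "real^'n" and x :: "nat \<Rightarrow> real^'n"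
  assumes "invertible (mat 1 - M)"
    and "M \<noteq> 0"
    and "onorm ((*v) M) \<le> 1"
    and "norm (residual (affine_map M b) (x 1)) \<le> norm (residual (affine_map M b) (x 0))"
    and "aa1_iteration (affine_map M b) x"
  shows "\<forall>k\<ge>1. aa1_coeff (affine_map M b) x k > -1"
proof (intro allI impI)
  fix k :: nat
  assume "k \<ge> 1"
  have "norm (residual (affine_map M b) (x k)) \<le> norm (residual (affine_map M b) (x (k - 1)))"
  proof (cases "k = 1")
    case True
    then show ?thesis
      using assms(4) by simp
  next
    case False
    with \<open>k \<ge> 1\<close> have "k - 1 \<ge> 1" and "k - 1 + 1 = k"
      by simp_all
    then show ?thesis
      using norm_residual_decreasing[OF assms(3,5), of "k - 1"] by simp
  qed
  then show "aa1_coeff (affine_map M b) x k > -1"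
    by (rule aa1_coeff_greater_minus_one)
qed

end
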